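(* Let $(X_1,\unlhd_1,\wedge_1,\vee_1,0_1,1_1)$ and $(X_2,\unlhd_2,\wedge_2,\vee_2,0_2,1_2)$ be two bounded trellises, $T$ a pseudo-t-norm on $X_2$ and $\rho:X_1\to X_2$ an isomorphism. Then the binary operation $T^\rho$ on $X_1$ defined by $T^\rho(x,y)=\rho^{-1}(T(\rho(x),\rho(y)))$ for all $x,y\in X_1$ is a pseudo-t-norm on $X_1$.
   Context: A pseudo-order $\unlhd$ on a set $X$ is a reflexive and antisymmetric relation (not necessarily transitive); lower/upper bounds, infima and suprema are defined as for partially ordered sets (they are unique when they exist). A trellis $(X,\unlhd,\wedge,\vee)$ is a set with a pseudo-order in which any two elements $x,y$ have an infimum $x\wedge y$ and a supremum $x\vee y$. It is bounded, written $(X,\unlhd,\wedge,\vee,0,1)$, if it has elements $0,1$ with $0\unlhd x\unlhd 1$ for all $x\in X$. An isomorphism of trellises $\rho:X_1\to X_2$ is a bijection with $\rho(x\wedge_1 y)=\rho(x)\wedge_2\rho(y)$ and $\rho(x\vee_1 y)=\rho(x)\vee_2\rho(y)$ for all $x,y\in X_1$. An element $\alpha\in X$ is right-transitive if $\alpha\unlhd x\unlhd y$ implies $\alpha\unlhd y$; left-transitive if $x\unlhd y\unlhd\alpha$ implies $x\unlhd\alpha$; middle-transitive if $x\unlhd\alpha\unlhd y$ implies $x\unlhd y$ (for all $x,y\in X$); transitive if all three hold. A triple $(x,y,z)$ is $\wedge$-associative if $(x\wedge y)\wedge z=x\wedge(y\wedge z)$, and $\vee$-associative if $(x\vee y)\vee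 z=x\vee(y\vee z)$. An element is $\wedge$-associative (resp. $\vee$-associative) if every triple in $X^3$ containing it is $\wedge$-associative (resp. $\vee$-associative). A binary operation $F$ on $X$ is weakly-increasing if, whenever $x\unlhd y$ and at least one of $x,y$ is transitive, $F(x,z)\unlhd F(y,z)$ for all $z\in X$. It is weakly-associative if $F(x,F(y,z))=F(F(x,y),z)$ for all $x,y,z\in X$ such that at least one of $x,y,z$ is $\wedge$-associative or at least one of $x,y,z$ is $\vee$-associative. A pseudo-t-norm on $X$ is a commutative, weakly-increasing, weakly-associative binary operation $T$ with $T(1,x)=x$ for all $x\in X$. *)

theory Defs
  imports Main
begin

text \<open>
  Structures live on a carrier set \<open>X\<close> inside an arbitrary type, so every property below is
  relativised to \<open>X\<close>; the values of relations and operations outside \<open>X\<close> are irrelevant.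
\<close>

definition pseudo_order_on :: "'a set \<Rightarrow> ('a \<Rightarrow> 'a \<Rightarrow> bool) \<Rightarrow> bool" where
  "pseudo_order_on X le \<longleftrightarrow> reflp_on X le \<and> antisymp_on X le"

definition lower_bound :: "'a set \<Rightarrow> ('a \<Rightarrow> 'a \<Rightarrow> bool) \<Rightarrow> 'a set \<Rightarrow> 'a \<Rightarrow> bool" where
  "lower_bound X le A l \<longleftrightarrow> l \<in> X \<and> (\<forall>a\<in>A. le l a)"

definition upper_bound :: "'a set \<Rightarrow> ('a \<Rightarrow> 'a \<Rightarrow> bool) \<Rightarrow> 'a set \<Rightarrow> 'a \<Rightarrow> bool" where
  "upper_bound X le A u \<longleftrightarrow> u \<in> X \<and> (\<forall>a\<in>A. le a u)"

definition infimum :: "'a set \<Rightarrow> ('a \<Rightarrow> 'a \<Rightarrow> bool) \<Rightarrow> 'a set \<Rightarrow> 'a \<Rightarrow> bool" where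
  "infimum X le A m \<longleftrightarrow> lower_bound X le A m \<and> (\<forall>l. lower_bound X le A l \<longrightarrow> le l m)"

definition supremum :: "'a set \<Rightarrow> ('a \<Rightarrow> 'a \<Rightarrow> bool) \<Rightarrow> 'a set \<Rightarrow> 'a \<Rightarrow> bool" where
  "supremum X le A j \<longleftrightarrow> upper_bound X le A j \<and> (\<forall>u. upper_bound X le A u \<longrightarrow> le j u)"

locale trellis =
  fixes X :: "'a set"
    and le :: "'a \<Rightarrow> 'a \<Rightarrow> bool"
    and meet :: "'a \<Rightarrow> 'a \<Rightarrow> 'a"
    and join :: "'a \<Rightarrow> 'a \<Rightarrow> 'a"
  assumes pseudo_order: "pseudo_order_on X le"
    and meet_infimum: "\<lbrakk>x \<in> X; y \<in> X\<rbrakk> \<Longrightarrow> infimum X le {x, y} (meet x y)"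
    and join_supremum: "\<lbrakk>x \<in> X; y \<in> X\<rbrakk> \<Longrightarrow> supremum X le {x, y} (join x y)"

locale bounded_trellis = trellis X le meet join
  for X :: "'a set" and le meet join +
  fixes zero :: 'a and one :: 'a
  assumes zero_closed: "zero \<in> X"
    and one_closed: "one \<in> X"
    and zero_le: "x \<in> X \<Longrightarrow> le zero x"
    and le_one: "x \<in> X \<Longrightarrow> le x one"

definition trellis_iso ::
  "'a set \<Rightarrow> ('a \<Rightarrow> 'a \<Rightarrow> 'a) \<Rightarrow> ('a \<Rightarrow> 'a \<Rightarrow> 'a) \<Rightarrow>
   'b set \<Rightarrow> ('b \<Rightarrow> 'b \<Rightarrow> 'b) \<Rightarrow> ('b \<Rightarrow> 'b \<Rightarrow> 'b) \<Rightarrow> ('a \<Rightarrow> 'b) \<Rightarrow> bool" where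
  "trellis_iso X\<^sub>1 meet\<^sub>1 join\<^sub>1 X\<^sub>2 meet\<^sub>2 join\<^sub>2 \<rho> \<longleftrightarrow>
     bij_betw \<rho> X\<^sub>1 X\<^sub>2 \<and>
     (\<forall>x\<in>X\<^sub>1. \<forall>y\<in>X\<^sub>1. \<rho> (meet\<^sub>1 x y) = meet\<^sub>2 (\<rho> x) (\<rho> y)) \<and>
     (\<forall>x\<in>X\<^sub>1. \<forall>y\<in>X\<^sub>1. \<rho> (join\<^sub>1 x y) = join\<^sub>2 (\<rho> x) (\<rho> y))"

definition right_transitive :: "'a set \<Rightarrow> ('a \<Rightarrow> 'a \<Rightarrow> bool) \<Rightarrow> 'a \<Rightarrow> bool" where
  "right_transitive X le \<alpha> \<longleftrightarrow> (\<forall>x\<in>X. \<forall>y\<in>X. le \<alpha> x \<and> le x y \<longrightarrow> le \<alpha> y)"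

definition left_transitive :: "'a set \<Rightarrow> ('a \<Rightarrow> 'a \<Rightarrow> bool) \<Rightarrow> 'a \<Rightarrow> bool" where
  "left_transitive X le \<alpha> \<longleftrightarrow> (\<forall>x\<in>X. \<forall>y\<in>X. le x y \<and> le y \<alpha> \<longrightarrow> le x \<alpha>)"

definition middle_transitive :: "'a set \<Rightarrow> ('a \<Rightarrow> 'a \<Rightarrow> bool) \<Rightarrow> 'a \<Rightarrow> bool" where
  "middle_transitive X le \<alpha> \<longleftrightarrow> (\<forall>x\<in>X. \<forall>y\<in>X. le x \<alpha> \<and> le \<alpha> y \<longrightarrow> le x y)"

definition transitive_elem :: "'a set \<Rightarrow> ('a \<Rightarrow> 'a \<Rightarrow> bool) \<Rightarrow> 'a \<Rightarrow> bool" where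
  "transitive_elem X le \<alpha> \<longleftrightarrow>
     right_transitive X le \<alpha> \<and> left_transitive X le \<alpha> \<and> middle_transitive X le \<alpha>"

definition assoc_triple :: "('a \<Rightarrow> 'a \<Rightarrow> 'a) \<Rightarrow> 'a \<Rightarrow> 'a \<Rightarrow> 'a \<Rightarrow> bool" where
  "assoc_triple f x y z \<longleftrightarrow> f (f x y) z = f x (f y z)"

text \<open>Instantiated with \<open>f = meet\<close> and \<open>f = join\<close> this gives the meet- and join-associative elements.\<close>

definition assoc_elem :: "'a set \<Rightarrow> ('a \<Rightarrow> 'a \<Rightarrow> 'a) \<Rightarrow> 'a \<Rightarrow> bool" where
  "assoc_elem X f \<alpha> \<longleftrightarrow>
     (\<forall>x\<in>X. \<forall>y\<in>X. \<forall>z\<in>X. \<alpha> \<in> {x, y, z} \<longrightarrow> assoc_triple f x y z)"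

definition binary_op_on :: "'a set \<Rightarrow> ('a \<Rightarrow> 'a \<Rightarrow> 'a) \<Rightarrow> bool" where
  "binary_op_on X F \<longleftrightarrow> (\<forall>x\<in>X. \<forall>y\<in>X. F x y \<in> X)"

definition weakly_increasing ::
  "'a set \<Rightarrow> ('a \<Rightarrow> 'a \<Rightarrow> bool) \<Rightarrow> ('a \<Rightarrow> 'a \<Rightarrow> 'a) \<Rightarrow> bool" where
  "weakly_increasing X le F \<longleftrightarrow>
     (\<forall>x\<in>X. \<forall>y\<in>X. le x y \<and> (transitive_elem X le x \<or> transitive_elem X le y) \<longrightarrow>
        (\<forall>z\<in>X. le (F x z) (F y z)))"

definition weakly_associative ::
  "'a set \<Rightarrow> ('a \<Rightarrow> 'a \<Rightarrow> 'a) \<Rightarrow> ('a \<Rightarrow> 'a \<Rightarrow> 'a) \<Rightarrow> ('a \<Rightarrow> 'a \<Rightarrow> 'a) \<Rightarrow> bool" where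
  "weakly_associative X meet join F \<longleftrightarrow>
     (\<forall>x\<in>X. \<forall>y\<in>X. \<forall>z\<in>X.
        (\<exists>w\<in>{x, y, z}. assoc_elem X meet w) \<or> (\<exists>w\<in>{x, y, z}. assoc_elem X join w) \<longrightarrow>
        F x (F y z) = F (F x y) z)"

definition pseudo_t_norm ::
  "'a set \<Rightarrow> ('a \<Rightarrow> 'a \<Rightarrow> bool) \<Rightarrow> ('a \<Rightarrow> 'a \<Rightarrow> 'a) \<Rightarrow> ('a \<Rightarrow> 'a \<Rightarrow> 'a) \<Rightarrow> 'a \<Rightarrow>
   ('a \<Rightarrow> 'a \<Rightarrow> 'a) \<Rightarrow> bool" where
  "pseudo_t_norm X le meet join one T \<longleftrightarrow>
     binary_op_on X T \<and>
     (\<forall>x\<in>X. \<forall>y\<in>X. T x y = T y x) \<and>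
     weakly_increasing X le T \<and>
     weakly_associative X meet join T \<and>
     (\<forall>x\<in>X. T one x = x)"

end

theory Submission
  imports Defs
begin

text \<open>
  A pseudo-t-norm is described entirely by the pseudo-order, meet, join and the top
  element, so the claim is transport of structure. An isomorphism of trellises is only asked
  to preserve meets and joins; it remains to see that it preserves the rest.

  The pseudo-order is recovered from the meet: \<open>x \<unlhd> y\<close> holds iff \<open>meet x y = x\<close>, a
  consequence of reflexivity and antisymmetry (\<open>le_iff_meet\<close>). Hence a bijection compatible
  with meets is an order isomorphism (\<open>trellis_iso_le_iff\<close>), and therefore maps transitive elements
  to transitive elements (\<open>transitive_elem_image\<close>) and the top to the top (\<open>trellis_iso_one\<close>).
  A bijection compatible with an operation carries its associative elements over
  (\<open>assoc_elem_image\<close>).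

  Weak monotonicity and weak associativity are conditional, and the two directions of
  transport play different roles: the hypotheses on elements of \<open>X\<^sub>1\<close> pass to their images in
  \<open>X\<^sub>2\<close>, where the property of \<open>T\<close> applies, and the conclusions come back because \<open>\<rho>\<close> maps the
  transported operation to \<open>T\<close>, reflects the pseudo-order and is injective.
\<close>

context trellis
begin

lemma meet_closed: "x \<in> X \<Longrightarrow> y \<in> X \<Longrightarrow> meet x y \<in> X"
  using meet_infimum[of x y] by (simp add: infimum_def lower_bound_def)

lemma join_closed: "x \<in> X \<Longrightarrow> y \<in> X \<Longrightarrow> join x y \<in> X"
  using join_supremum[of x y] by (simp add: supremum_def upper_bound_def)

text \<open>
  If \<open>x \<unlhd> y\<close>, reflexivity makes \<open>x\<close> itself a lower bound of \<open>{x, y}\<close>, hence \<open>x \<unlhd> meet x y\<close>;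
  as \<open>meet x y \<unlhd> x\<close>, antisymmetry gives equality.
\<close>

lemma le_iff_meet:
  assumes x: "x \<in> X" and y: "y \<in> X"
  shows "le x y \<longleftrightarrow> meet x y = x"
proof
  have inf: "infimum X le {x, y} (meet x y)"
    using meet_infimum[OF x y] .
  show "le x y" if "meet x y = x"
    using inf that by (simp add: infimum_def lower_bound_def)
  show "meet x y = x" if "le x y"
  proof -
    have "lower_bound X le {x, y} x"
      using pseudo_order x that
      by (auto simp: lower_bound_def pseudo_order_on_def dest: reflp_onD)
    then have "le x (meet x y)" "le (meet x y) x" "meet x y \<in> X"
      using inf by (auto simp: infimum_def lower_bound_def)
    then show ?thesis
      using pseudo_order x by (auto simp: pseudo_order_on_def dest: antisymp_onD)
  qed
qed

end

lemma trellis_iso_le_iff: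
  assumes "trellis X\<^sub>1 le\<^sub>1 meet\<^sub>1 join\<^sub>1" and "trellis X\<^sub>2 le\<^sub>2 meet\<^sub>2 join\<^sub>2"
    and iso: "trellis_iso X\<^sub>1 meet\<^sub>1 join\<^sub>1 X\<^sub>2 meet\<^sub>2 join\<^sub>2 \<rho>"
    and x: "x \<in> X\<^sub>1" and y: "y \<in> X\<^sub>1"
  shows "le\<^sub>2 (\<rho> x) (\<rho> y) \<longleftrightarrow> le\<^sub>1 x y"
proof -
  interpret A: trellis X\<^sub>1 le\<^sub>1 meet\<^sub>1 join\<^sub>1 by fact
  interpret B: trellis X\<^sub>2 le\<^sub>2 meet\<^sub>2 join\<^sub>2 by fact
  have bij: "bij_betw \<rho> X\<^sub>1 X\<^sub>2" and meet: "\<rho> (meet\<^sub>1 x y) = meet\<^sub>2 (\<rho> x) (\<rho> y)"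
    using iso x y by (simp_all add: trellis_iso_def)
  have "le\<^sub>2 (\<rho> x) (\<rho> y) \<longleftrightarrow> meet\<^sub>2 (\<rho> x) (\<rho> y) = \<rho> x"
    by (intro B.le_iff_meet bij_betw_apply[OF bij] x y)
  also have "\<dots> \<longleftrightarrow> meet\<^sub>1 x y = x"
    unfolding meet[symmetric]
    by (intro inj_on_eq_iff[OF bij_betw_imp_inj_on[OF bij]] A.meet_closed x y)
  also have "\<dots> \<longleftrightarrow> le\<^sub>1 x y"
    using A.le_iff_meet[OF x y] ..
  finally show ?thesis .
qed

text \<open>
  Surjectivity writes the top of the second trellis as an image; since the first top dominates
  the preimage, the image of the first top dominates the second, and antisymmetry concludes.
\<close>

lemma trellis_iso_one:
  assumes "bounded_trellis X\<^sub>1 le\<^sub>1 meet\<^sub>1 join\<^sub>1 zero\<^sub>1 one\<^sub>1"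
    and "bounded_trellis X\<^sub>2 le\<^sub>2 meet\<^sub>2 join\<^sub>2 zero\<^sub>2 one\<^sub>2"
    and iso: "trellis_iso X\<^sub>1 meet\<^sub>1 join\<^sub>1 X\<^sub>2 meet\<^sub>2 join\<^sub>2 \<rho>"
  shows "\<rho> one\<^sub>1 = one\<^sub>2"
proof -
  interpret A: bounded_trellis X\<^sub>1 le\<^sub>1 meet\<^sub>1 join\<^sub>1 zero\<^sub>1 one\<^sub>1 by fact
  interpret B: bounded_trellis X\<^sub>2 le\<^sub>2 meet\<^sub>2 join\<^sub>2 zero\<^sub>2 one\<^sub>2 by fact
  have bij: "bij_betw \<rho> X\<^sub>1 X\<^sub>2"
    using iso by (simp add: trellis_iso_def)
  have closed: "\<rho> one\<^sub>1 \<in> X\<^sub>2"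
    using bij_betw_apply[OF bij A.one_closed] .
  obtain u where u: "u \<in> X\<^sub>1" "one\<^sub>2 = \<rho> u"
    using B.one_closed bij by (auto simp: bij_betw_def)
  have "le\<^sub>2 one\<^sub>2 (\<rho> one\<^sub>1)"
    using trellis_iso_le_iff[OF A.trellis_axioms B.trellis_axioms iso u(1) A.one_closed]
      A.le_one[OF u(1)] u(2) by simp
  then show ?thesis
    using B.le_one[OF closed] B.pseudo_order closed B.one_closed
    by (auto simp: pseudo_order_on_def dest: antisymp_onD)
qed

lemma transitive_elem_image:
  assumes surj: "f ` X = Y"
    and le: "\<And>x y. x \<in> X \<Longrightarrow> y \<in> X \<Longrightarrow> le' (f x) (f y) \<longleftrightarrow> le x y"
    and a: "a \<in> X" and trans: "transitive_elem X le a"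
  shows "transitive_elem Y le' (f a)"
proof -
  have R: "\<forall>x\<in>X. \<forall>y\<in>X. le a x \<and> le x y \<longrightarrow> le a y"
    and L: "\<forall>x\<in>X. \<forall>y\<in>X. le x y \<and> le y a \<longrightarrow> le x a"
    and M: "\<forall>x\<in>X. \<forall>y\<in>X. le x a \<and> le a y \<longrightarrow> le x y"
    using trans
    unfolding transitive_elem_def right_transitive_def left_transitive_def middle_transitive_def
    by blast+
  have "right_transitive Y le' (f a)"
    unfolding surj[symmetric] right_transitive_def using R le a by blast
  moreover have "left_transitive Y le' (f a)"
    unfolding surj[symmetric] left_transitive_def using L le a by blast
  moreover have "middle_transitive Y le' (f a)"
    unfolding surj[symmetric] middle_transitive_def using M le a by blast
  ultimately show ?thesis
    by (simp add: transitive_elem_def)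
qed

text \<open>
  Injectivity serves to recognise, among triples of \<open>Y\<close>, those containing \<open>f a\<close> as the images of
  triples containing \<open>a\<close>.
\<close>

lemma assoc_elem_image:
  assumes bij: "bij_betw f X Y"
    and closed: "\<And>x y. x \<in> X \<Longrightarrow> y \<in> X \<Longrightarrow> g x y \<in> X"
    and hom: "\<And>x y. x \<in> X \<Longrightarrow> y \<in> X \<Longrightarrow> f (g x y) = h (f x) (f y)"
    and a: "a \<in> X" and assoc: "assoc_elem X g a"
  shows "assoc_elem Y h (f a)"
proof -
  have inj: "inj_on f X" and surj: "f ` X = Y"
    using bij by (simp_all add: bij_betw_def)
  have "assoc_triple h (f x) (f y) (f z)"
    if mem: "x \<in> X" "y \<in> X" "z \<in> X" and fa: "f a \<in> {f x, f y, f z}" for x y z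
  proof -
    have "a \<in> {x, y, z}"
      using fa mem a inj by (auto dest: inj_onD)
    then have "g (g x y) z = g x (g y z)"
      using assoc mem unfolding assoc_elem_def assoc_triple_def by blast
    then have "f (g (g x y) z) = f (g x (g y z))"
      by simp
    then show ?thesis
      using mem by (simp add: assoc_triple_def hom closed)
  qed
  then show ?thesis
    unfolding surj[symmetric] assoc_elem_def by auto
qed

theorem proposition6p3:
  fixes X\<^sub>1 :: "'a set" and X\<^sub>2 :: "'b set"
    and le\<^sub>1 :: "'a \<Rightarrow> 'a \<Rightarrow> bool" and le\<^sub>2 :: "'b \<Rightarrow> 'b \<Rightarrow> bool"
    and meet\<^sub>1 join\<^sub>1 :: "'a \<Rightarrow> 'a \<Rightarrow> 'a" and meet\<^sub>2 join\<^sub>2 :: "'b \<Rightarrow> 'b \<Rightarrow> 'b"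
    and zero\<^sub>1 one\<^sub>1 :: 'a and zero\<^sub>2 one\<^sub>2 :: 'b
    and T :: "'b \<Rightarrow> 'b \<Rightarrow> 'b" and \<rho> :: "'a \<Rightarrow> 'b"
  assumes "bounded_trellis X\<^sub>1 le\<^sub>1 meet\<^sub>1 join\<^sub>1 zero\<^sub>1 one\<^sub>1"
    and "bounded_trellis X\<^sub>2 le\<^sub>2 meet\<^sub>2 join\<^sub>2 zero\<^sub>2 one\<^sub>2"
    and "pseudo_t_norm X\<^sub>2 le\<^sub>2 meet\<^sub>2 join\<^sub>2 one\<^sub>2 T"
    and "trellis_iso X\<^sub>1 meet\<^sub>1 join\<^sub>1 X\<^sub>2 meet\<^sub>2 join\<^sub>2 \<rho>"
  shows "pseudo_t_norm X\<^sub>1 le\<^sub>1 meet\<^sub>1 join\<^sub>1 one\<^sub>1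
           (\<lambda>x y. inv_into X\<^sub>1 \<rho> (T (\<rho> x) (\<rho> y)))"
proof -
  interpret A: bounded_trellis X\<^sub>1 le\<^sub>1 meet\<^sub>1 join\<^sub>1 zero\<^sub>1 one\<^sub>1 by fact
  interpret B: bounded_trellis X\<^sub>2 le\<^sub>2 meet\<^sub>2 join\<^sub>2 zero\<^sub>2 one\<^sub>2 by fact
  define S where "S = (\<lambda>x y. inv_into X\<^sub>1 \<rho> (T (\<rho> x) (\<rho> y)))"
  note iso = assms(4)
  have bij: "bij_betw \<rho> X\<^sub>1 X\<^sub>2"
    and hom_meet: "\<And>x y. x \<in> X\<^sub>1 \<Longrightarrow> y \<in> X\<^sub>1 \<Longrightarrow> \<rho> (meet\<^sub>1 x y) = meet\<^sub>2 (\<rho> x) (\<rho> y)"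
    and hom_join: "\<And>x y. x \<in> X\<^sub>1 \<Longrightarrow> y \<in> X\<^sub>1 \<Longrightarrow> \<rho> (join\<^sub>1 x y) = join\<^sub>2 (\<rho> x) (\<rho> y)"
    using iso by (simp_all add: trellis_iso_def)
  note img = bij_betw_apply[OF bij]
  note inj = bij_betw_imp_inj_on[OF bij]
  note surj = bij_betw_imp_surj_on[OF bij]
  note le = trellis_iso_le_iff[OF A.trellis_axioms B.trellis_axioms iso]
  have trans: "transitive_elem X\<^sub>2 le\<^sub>2 (\<rho> x)" if "x \<in> X\<^sub>1" "transitive_elem X\<^sub>1 le\<^sub>1 x" for x
    using surj le that by (rule transitive_elem_image)
  have assoc_meet: "assoc_elem X\<^sub>2 meet\<^sub>2 (\<rho> x)" if "x \<in> X\<^sub>1" "assoc_elem X\<^sub>1 meet\<^sub>1 x" for x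
    using bij A.meet_closed hom_meet that by (rule assoc_elem_image)
  have assoc_join: "assoc_elem X\<^sub>2 join\<^sub>2 (\<rho> x)" if "x \<in> X\<^sub>1" "assoc_elem X\<^sub>1 join\<^sub>1 x" for x
    using bij A.join_closed hom_join that by (rule assoc_elem_image)
  have T_closed: "T a b \<in> X\<^sub>2" if "a \<in> X\<^sub>2" "b \<in> X\<^sub>2" for a b
    using assms(3) that by (simp add: pseudo_t_norm_def binary_op_on_def)
  have S_closed: "S x y \<in> X\<^sub>1" if "x \<in> X\<^sub>1" "y \<in> X\<^sub>1" for x y
    unfolding S_def by (intro inv_into_into) (simp add: surj T_closed img that)
  have hom: "\<rho> (S x y) = T (\<rho> x) (\<rho> y)" if "x \<in> X\<^sub>1" "y \<in> X\<^sub>1" for x y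
    unfolding S_def by (intro f_inv_into_f) (simp add: surj T_closed img that)
  have "binary_op_on X\<^sub>1 S"
    by (simp add: binary_op_on_def S_closed)
  moreover have "\<forall>x\<in>X\<^sub>1. \<forall>y\<in>X\<^sub>1. S x y = S y x"
    using assms(3) by (simp add: S_def pseudo_t_norm_def img)
  moreover have "weakly_increasing X\<^sub>1 le\<^sub>1 S"
    unfolding weakly_increasing_def
  proof (intro ballI impI, elim conjE)
    fix x y z
    assume mem: "x \<in> X\<^sub>1" "y \<in> X\<^sub>1" "z \<in> X\<^sub>1" and xy: "le\<^sub>1 x y"
      and t: "transitive_elem X\<^sub>1 le\<^sub>1 x \<or> transitive_elem X\<^sub>1 le\<^sub>1 y"
    have "le\<^sub>2 (\<rho> x) (\<rho> y)"
      using le mem xy by simp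
    moreover have "transitive_elem X\<^sub>2 le\<^sub>2 (\<rho> x) \<or> transitive_elem X\<^sub>2 le\<^sub>2 (\<rho> y)"
      using t trans mem by blast
    ultimately have "le\<^sub>2 (T (\<rho> x) (\<rho> z)) (T (\<rho> y) (\<rho> z))"
      using assms(3) img mem by (simp add: pseudo_t_norm_def weakly_increasing_def)
    then have "le\<^sub>2 (\<rho> (S x z)) (\<rho> (S y z))"
      by (simp add: hom mem)
    then show "le\<^sub>1 (S x z) (S y z)"
      using le S_closed mem by simp
  qed
  moreover have "weakly_associative X\<^sub>1 meet\<^sub>1 join\<^sub>1 S"
    unfolding weakly_associative_def
  proof (intro ballI impI)
    fix x y z
    assume mem: "x \<in> X\<^sub>1" "y \<in> X\<^sub>1" "z \<in> X\<^sub>1"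
      and a: "(\<exists>w\<in>{x, y, z}. assoc_elem X\<^sub>1 meet\<^sub>1 w) \<or> (\<exists>w\<in>{x, y, z}. assoc_elem X\<^sub>1 join\<^sub>1 w)"
    have "(\<exists>w\<in>{\<rho> x, \<rho> y, \<rho> z}. assoc_elem X\<^sub>2 meet\<^sub>2 w) \<or>
        (\<exists>w\<in>{\<rho> x, \<rho> y, \<rho> z}. assoc_elem X\<^sub>2 join\<^sub>2 w)"
      using a assoc_meet assoc_join mem by blast
    then have "T (\<rho> x) (T (\<rho> y) (\<rho> z)) = T (T (\<rho> x) (\<rho> y)) (\<rho> z)"
      using assms(3) img[OF mem(1)] img[OF mem(2)] img[OF mem(3)]
      unfolding pseudo_t_norm_def weakly_associative_def by blast
    then have "\<rho> (S x (S y z)) = \<rho> (S (S x y) z)"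
      by (simp add: hom S_closed mem)
    then show "S x (S y z) = S (S x y) z"
      using inj by (simp add: inj_on_eq_iff S_closed mem)
  qed
  moreover have "\<forall>x\<in>X\<^sub>1. S one\<^sub>1 x = x"
    using assms(3) trellis_iso_one[OF assms(1,2) iso] inj
    by (simp add: S_def pseudo_t_norm_def img)
  ultimately show ?thesis
    by (simp add: pseudo_t_norm_def S_def[symmetric])
qed

end
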